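(* Let $G$ be a finite connected metric graph without terminal vertices, $T$ its universal covering tree, $\Gamma=\pi_1(G)$, and let $(Y,d)$ be a locally compact Hadamard space. Let $\Lambda$ be a group acting properly and co-compactly by isometries on $Y$, let $\rho:\Gamma\to\Lambda$ be a homomorphism, and let $Z$ be the centraliser of $\rho(\Gamma)$ in $\Lambda$. Then there are constants $C_\star$ and $C$ such that for any locally rectifiable $\rho$-equivariant maps $u,v:T\to Y$ there exists $h\in Z$ such that the $L_\infty$-width of the geodesic homotopy $H$ between $u$ and $h\cdot v$ satisfies $$W_\infty(H)\leqslant C_\star\big(L(u)+L(v)\big)+C.$$
   Context: A Hadamard space is a complete metric space $(Y,d)$ such that any two points are joined by a curve whose length equals their distance (a geodesic), and for any points $P,Q,R$ and $0\le\lambda\le1$, the point $Q_\lambda$ on the geodesic from $Q$ to $R$ with $d(Q_\lambda,Q)=\lambda d(Q,R)$ satisfies $d(P,Q_\lambda)^2\le(1-\lambda)d(P,Q)^2+\lambda d(P,R)^2-\lambda(1-\lambda)d(Q,R)^2$. The action of $\Lambda$ is proper if each $y\in Y$ has $r>0$ with $\{g\in\Lambda: gB(y,r)\cap B(y,r)\ne\varnothing\}$ finite, and co-compact if $Y/\Lambda$ is compact. Edges of $G$ and $T$ are identified with compact intervals; $\Gamma$ acts on $T$ by deck transformations. A map $u:T\to Y$ is $\rho$-equivariant if $u(g\cdot x)=\rho(g)\cdot u(x)$; locally rectifiable if each edge has rectifiable image; its length $L(u)$ is the sum over edges of $G$ of the lengths of $u$ restricted to lifts of these edges. For $h\in Z$,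 $(h\cdot v)(x)=h\cdot v(x)$ is $\rho$-equivariant. The geodesic homotopy $H$ between $u$ and $w$ is $H(s,x)=$ point at fraction $s$ of the geodesic from $u(x)$ to $w(x)$, and $W_\infty(H)=\sup_{x\in T}d(u(x),w(x))$. *)

theory Defs
  imports "HOL-Analysis.Analysis" "HOL-Algebra.Group"
begin

definition partition_sums :: "(real \<Rightarrow> 'y::metric_space) \<Rightarrow> real \<Rightarrow> real \<Rightarrow> real set" where
  "partition_sums f a b =
     {(\<Sum>i<n. dist (f (ts i)) (f (ts (Suc i)))) | n ts.
        ts 0 = a \<and> ts n = b \<and> (\<forall>i<n. ts i \<le> ts (Suc i))}"

definition rectifiable_curve :: "(real \<Rightarrow> 'y::metric_space) \<Rightarrow> real \<Rightarrow> real \<Rightarrow> bool" where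
  "rectifiable_curve f a b \<longleftrightarrow> continuous_on {a..b} f \<and> bdd_above (partition_sums f a b)"

definition curve_length :: "(real \<Rightarrow> 'y::metric_space) \<Rightarrow> real \<Rightarrow> real \<Rightarrow> real" where
  "curve_length f a b = Sup (partition_sums f a b)"

definition geodesic_curve :: "(real \<Rightarrow> 'y::metric_space) \<Rightarrow> 'y \<Rightarrow> 'y \<Rightarrow> bool" where
  "geodesic_curve \<gamma> x y \<longleftrightarrow> rectifiable_curve \<gamma> 0 1 \<and> \<gamma> 0 = x \<and> \<gamma> 1 = y
      \<and> curve_length \<gamma> 0 1 = dist x y"

definition hadamard_space :: "'y::metric_space itself \<Rightarrow> bool" where
  "hadamard_space _ \<longleftrightarrow>
     complete (UNIV :: 'y set) \<and>
     (\<forall>x y::'y. \<exists>\<gamma>. geodesic_curve \<gamma> x y) \<and>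
     (\<forall>P Q R :: 'y. \<forall>\<gamma> lam s. geodesic_curve \<gamma> Q R \<and> 0 \<le> lam \<and> lam \<le> 1 \<and> s \<in> {0..1}
         \<and> dist (\<gamma> s) Q = lam * dist Q R \<longrightarrow>
         (dist P (\<gamma> s))\<^sup>2 \<le> (1 - lam) * (dist P Q)\<^sup>2 + lam * (dist P R)\<^sup>2
                              - lam * (1 - lam) * (dist Q R)\<^sup>2)"

definition locally_compact_space :: "'y::metric_space itself \<Rightarrow> bool" where
  "locally_compact_space _ \<longleftrightarrow>
     (\<forall>y::'y. \<exists>U K. open U \<and> compact K \<and> y \<in> U \<and> U \<subseteq> K)"

definition isometric_action :: "('l, 'm) monoid_scheme \<Rightarrow> ('l \<Rightarrow> 'y::metric_space \<Rightarrow> 'y) \<Rightarrow> bool" where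
  "isometric_action L act \<longleftrightarrow>
     (\<forall>x. act \<one>\<^bsub>L\<^esub> x = x) \<and>
     (\<forall>g\<in>carrier L. \<forall>h\<in>carrier L. \<forall>x. act (g \<otimes>\<^bsub>L\<^esub> h) x = act g (act h x)) \<and>
     (\<forall>g\<in>carrier L. \<forall>x y. dist (act g x) (act g y) = dist x y)"

definition proper_action :: "('l, 'm) monoid_scheme \<Rightarrow> ('l \<Rightarrow> 'y::metric_space \<Rightarrow> 'y) \<Rightarrow> bool" where
  "proper_action L act \<longleftrightarrow>
     (\<forall>y. \<exists>r>0. finite {g \<in> carrier L. act g ` ball y r \<inter> ball y r \<noteq> {}})"

text \<open>Co-compactness: the orbit space Y/Lambda (with the quotient topology) is compact.
  Open sets of Y/Lambda correspond exactly to Lambda-invariant open subsets of Y, so this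
  says every cover of Y by invariant open sets has a finite subcover.\<close>
definition invariant_set :: "('l, 'm) monoid_scheme \<Rightarrow> ('l \<Rightarrow> 'y \<Rightarrow> 'y) \<Rightarrow> 'y set \<Rightarrow> bool" where
  "invariant_set L act U \<longleftrightarrow> (\<forall>g\<in>carrier L. act g ` U \<subseteq> U)"

definition cocompact_action :: "('l, 'm) monoid_scheme \<Rightarrow> ('l \<Rightarrow> 'y::metric_space \<Rightarrow> 'y) \<Rightarrow> bool" where
  "cocompact_action L act \<longleftrightarrow>
     (\<forall>\<U>. (\<forall>U\<in>\<U>. open U \<and> invariant_set L act U) \<and> \<Union>\<U> = UNIV \<longrightarrow>
          (\<exists>\<F>\<subseteq>\<U>. finite \<F> \<and> \<Union>\<F> = UNIV))"

text \<open>A graph: vertex set V, edge set E, endpoint maps src, tgt (loops and multiple edges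
  allowed), and edge lengths len (edge e is identified with [0, len e], 0 at src e).
  Oriented edges are pairs (e, True) (from src to tgt) and (e, False) (reversed).\<close>

definition metric_graph :: "'v set \<Rightarrow> 'e set \<Rightarrow> ('e \<Rightarrow> 'v) \<Rightarrow> ('e \<Rightarrow> 'v) \<Rightarrow> ('e \<Rightarrow> real) \<Rightarrow> bool" where
  "metric_graph V E src tgt len \<longleftrightarrow> finite V \<and> finite E \<and>
     (\<forall>e\<in>E. src e \<in> V \<and> tgt e \<in> V \<and> len e > 0)"

fun otail :: "('e \<Rightarrow> 'v) \<Rightarrow> ('e \<Rightarrow> 'v) \<Rightarrow> 'e \<times> bool \<Rightarrow> 'v" where
  "otail src tgt (e, b) = (if b then src e else tgt e)"

fun ohead :: "('e \<Rightarrow> 'v) \<Rightarrow> ('e \<Rightarrow> 'v) \<Rightarrow> 'e \<times> bool \<Rightarrow> 'v" where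
  "ohead src tgt (e, b) = (if b then tgt e else src e)"

fun oflip :: "'e \<times> bool \<Rightarrow> 'e \<times> bool" where
  "oflip (e, b) = (e, \<not> b)"

fun is_path :: "'e set \<Rightarrow> ('e \<Rightarrow> 'v) \<Rightarrow> ('e \<Rightarrow> 'v) \<Rightarrow> 'v \<Rightarrow> 'v \<Rightarrow> ('e \<times> bool) list \<Rightarrow> bool" where
  "is_path E src tgt v w [] \<longleftrightarrow> v = w"
| "is_path E src tgt v w (oe # ps) \<longleftrightarrow>
     fst oe \<in> E \<and> otail src tgt oe = v \<and> is_path E src tgt (ohead src tgt oe) w ps"

fun reduced :: "('e \<times> bool) list \<Rightarrow> bool" where
  "reduced [] = True"
| "reduced [x] = True"
| "reduced (x # y # zs) \<longleftrightarrow> y \<noteq> oflip x \<and> reduced (y # zs)"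

definition red_step :: "'e \<times> bool \<Rightarrow> ('e \<times> bool) list \<Rightarrow> ('e \<times> bool) list" where
  "red_step x ys = (case ys of [] \<Rightarrow> [x] | y # ys' \<Rightarrow> if y = oflip x then ys' else x # ys)"

definition reduce :: "('e \<times> bool) list \<Rightarrow> ('e \<times> bool) list" where
  "reduce xs = foldr red_step xs []"

definition connected_graph :: "'v set \<Rightarrow> 'e set \<Rightarrow> ('e \<Rightarrow> 'v) \<Rightarrow> ('e \<Rightarrow> 'v) \<Rightarrow> bool" where
  "connected_graph V E src tgt \<longleftrightarrow> (\<forall>v\<in>V. \<forall>w\<in>V. \<exists>p. is_path E src tgt v w p)"

definition valence :: "'e set \<Rightarrow> ('e \<Rightarrow> 'v) \<Rightarrow> ('e \<Rightarrow> 'v) \<Rightarrow> 'v \<Rightarrow> nat" where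
  "valence E src tgt w = card {e\<in>E. src e = w} + card {e\<in>E. tgt e = w}"

definition no_terminal_vertices :: "'v set \<Rightarrow> 'e set \<Rightarrow> ('e \<Rightarrow> 'v) \<Rightarrow> ('e \<Rightarrow> 'v) \<Rightarrow> bool" where
  "no_terminal_vertices V E src tgt \<longleftrightarrow> (\<forall>w\<in>V. valence E src tgt w \<noteq> 1)"

text \<open>Fundamental group pi_1(G, v0): reduced closed edge paths at v0, with product
  g * h = reduce (g @ h).\<close>
definition fund_group :: "'e set \<Rightarrow> ('e \<Rightarrow> 'v) \<Rightarrow> ('e \<Rightarrow> 'v) \<Rightarrow> 'v \<Rightarrow> ('e \<times> bool) list set" where
  "fund_group E src tgt v0 = {g. is_path E src tgt v0 v0 g \<and> reduced g}"

text \<open>Universal covering tree T (based at v0): its vertices are the reduced edge paths from v0.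
  A point of T is represented by a triple (p, oe, t): p a reduced path from v0 to the tail of
  the oriented edge oe of G, and 0 <= t <= len (fst oe); it is the point at distance t from the
  vertex p along the lift of oe starting at p.  Several triples represent the same point:
  (p, oe, 0) is the vertex p for every oe, and (p, oe, t) equals
  (reduce (p @ [oe]), oflip oe, len - t).  The deck action of g in pi_1 is
  g . (p, oe, t) = (reduce (g @ p), oe, t).\<close>
definition tree_point :: "'e set \<Rightarrow> ('e \<Rightarrow> 'v) \<Rightarrow> ('e \<Rightarrow> 'v) \<Rightarrow> ('e \<Rightarrow> real) \<Rightarrow> 'v
    \<Rightarrow> ('e \<times> bool) list \<times> ('e \<times> bool) \<times> real \<Rightarrow> bool" where
  "tree_point E src tgt len v0 x \<longleftrightarrow> (case x of (p, oe, t) \<Rightarrow>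
     is_path E src tgt v0 (otail src tgt oe) p \<and> reduced p \<and> fst oe \<in> E \<and>
     0 \<le> t \<and> t \<le> len (fst oe))"

text \<open>A function on representatives that descends to a well-defined map T -> Y.\<close>
definition tree_map :: "'e set \<Rightarrow> ('e \<Rightarrow> 'v) \<Rightarrow> ('e \<Rightarrow> 'v) \<Rightarrow> ('e \<Rightarrow> real) \<Rightarrow> 'v
    \<Rightarrow> (('e \<times> bool) list \<times> ('e \<times> bool) \<times> real \<Rightarrow> 'y) \<Rightarrow> bool" where
  "tree_map E src tgt len v0 u \<longleftrightarrow>
     (\<forall>p oe oe'. tree_point E src tgt len v0 (p, oe, 0) \<and> tree_point E src tgt len v0 (p, oe', 0)
        \<longrightarrow> u (p, oe, 0) = u (p, oe', 0)) \<and>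
     (\<forall>p oe t. tree_point E src tgt len v0 (p, oe, t) \<longrightarrow>
        u (p, oe, t) = u (reduce (p @ [oe]), oflip oe, len (fst oe) - t))"

definition equivariant_map :: "'e set \<Rightarrow> ('e \<Rightarrow> 'v) \<Rightarrow> ('e \<Rightarrow> 'v) \<Rightarrow> ('e \<Rightarrow> real) \<Rightarrow> 'v
    \<Rightarrow> ('l \<Rightarrow> 'y \<Rightarrow> 'y) \<Rightarrow> (('e \<times> bool) list \<Rightarrow> 'l)
    \<Rightarrow> (('e \<times> bool) list \<times> ('e \<times> bool) \<times> real \<Rightarrow> 'y) \<Rightarrow> bool" where
  "equivariant_map E src tgt len v0 act \<rho> u \<longleftrightarrow>
     tree_map E src tgt len v0 u \<and>
     (\<forall>g\<in>fund_group E src tgt v0. \<forall>p oe t. tree_point E src tgt len v0 (p, oe, t) \<longrightarrow>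
        u (reduce (g @ p), oe, t) = act (\<rho> g) (u (p, oe, t)))"

definition locally_rectifiable :: "'e set \<Rightarrow> ('e \<Rightarrow> 'v) \<Rightarrow> ('e \<Rightarrow> 'v) \<Rightarrow> ('e \<Rightarrow> real) \<Rightarrow> 'v
    \<Rightarrow> (('e \<times> bool) list \<times> ('e \<times> bool) \<times> real \<Rightarrow> 'y::metric_space) \<Rightarrow> bool" where
  "locally_rectifiable E src tgt len v0 u \<longleftrightarrow>
     (\<forall>p oe. tree_point E src tgt len v0 (p, oe, 0) \<longrightarrow>
        rectifiable_curve (\<lambda>t. u (p, oe, t)) 0 (len (fst oe)))"

definition lift_vertex :: "'e set \<Rightarrow> ('e \<Rightarrow> 'v) \<Rightarrow> ('e \<Rightarrow> 'v) \<Rightarrow> 'v \<Rightarrow> 'v \<Rightarrow> ('e \<times> bool) list" where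
  "lift_vertex E src tgt v0 w = (SOME p. is_path E src tgt v0 w p \<and> reduced p)"

definition map_length :: "'e set \<Rightarrow> ('e \<Rightarrow> 'v) \<Rightarrow> ('e \<Rightarrow> 'v) \<Rightarrow> ('e \<Rightarrow> real) \<Rightarrow> 'v
    \<Rightarrow> (('e \<times> bool) list \<times> ('e \<times> bool) \<times> real \<Rightarrow> 'y::metric_space) \<Rightarrow> real" where
  "map_length E src tgt len v0 u =
     (\<Sum>e\<in>E. curve_length (\<lambda>t. u (lift_vertex E src tgt v0 (src e), (e, True), t)) 0 (len e))"

definition centraliser_image :: "('l, 'm) monoid_scheme \<Rightarrow> 'g set \<Rightarrow> ('g \<Rightarrow> 'l) \<Rightarrow> 'l set" where
  "centraliser_image L Gam \<rho> =
     {z \<in> carrier L. \<forall>g\<in>Gam. z \<otimes>\<^bsub>L\<^esub> \<rho> g = \<rho> g \<otimes>\<^bsub>L\<^esub> z}"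

end

theory Submission
  imports Defs
begin

text \<open>Let \<open>S\<close> be a finite generating set of \<open>\<Gamma>\<close> and let the displacement of \<open>p\<close> be the largest
  \<open>d(p, \<rho>(s) p)\<close> with \<open>s\<close> in \<open>S\<close>; at \<open>p = u(o)\<close>, for a base vertex \<open>o\<close> of \<open>T\<close>, it is at most a constant times
  \<open>L(u)\<close>.  Moving a point of a sublevel set of the displacement into a fundamental domain of \<open>\<Lambda>\<close>
  conjugates \<open>\<rho>(S)\<close> into a finite set, by properness, so \<open>Z\<close> acts coboundedly on each sublevel set.
  As the displacement is convex, it therefore grows at least linearly in the distance to an orbit of
  \<open>Z\<close>.  Hence \<open>u(o)\<close> and \<open>v(o)\<close> both lie at distance \<open>O(L(u) + L(v) + 1)\<close> from one \<open>Z\<close>-orbit, and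
  equivariance spreads the resulting bound from \<open>o\<close> to all of \<open>T\<close>.\<close>

subsection \<open>Convexity of the metric\<close>

text \<open>The points \<open>a\<close>, \<open>s\<close>, \<open>t\<close>, \<open>b\<close> form a
  partition, so the chord sum lies below the supremum. The choice \<open>s = t\<close> gives the
  two-chord bound used for geodesics.\<close>

lemma dist_le_curve_length:
  fixes f :: "real \<Rightarrow> 'y::metric_space"
  assumes "rectifiable_curve f a b" "a \<le> s" "s \<le> t" "t \<le> b"
  shows "dist (f a) (f s) + dist (f s) (f t) + dist (f t) (f b) \<le> curve_length f a b"
proof -
  let ?ts = "\<lambda>i::nat. if i = 0 then a else if i = 1 then s else if i = 2 then t else b"
  have "(\<Sum>i<3. dist (f (?ts i)) (f (?ts (Suc i)))) \<in> partition_sums f a b"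
    unfolding partition_sums_def using assms
    by (intro CollectI exI[of _ "3::nat"] exI[of _ ?ts]) auto
  moreover have "(\<Sum>i<3. dist (f (?ts i)) (f (?ts (Suc i))))
      = dist (f a) (f s) + dist (f s) (f t) + dist (f t) (f b)"
    by (simp add: eval_nat_numeral)
  ultimately show ?thesis
    using assms(1) unfolding rectifiable_curve_def curve_length_def
    by (metis (no_types, lifting) cSup_upper)
qed

text \<open>Records the point at fraction \<open>l\<close> without its curve. The two distances and
  the inequality survive reversal and isometries, and already determine \<open>m\<close>
  uniquely.\<close>

definition cat0_point :: "'y::metric_space \<Rightarrow> 'y \<Rightarrow> real \<Rightarrow> 'y \<Rightarrow> bool" where
  "cat0_point q r l m \<longleftrightarrow> dist m q = l * dist q r \<and> dist m r = (1 - l) * dist q r \<and>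
     (\<forall>p. (dist p m)\<^sup>2 \<le> (1 - l) * (dist p q)\<^sup>2 + l * (dist p r)\<^sup>2 - l * (1 - l) * (dist q r)\<^sup>2)"

text \<open>A geodesic curve need not be parametrised proportionally to arc length, so the
  intermediate value theorem locates the parameter. Equality of length and distance then forces the
  distance to \<open>r\<close>.\<close>

lemma cat0_point_exists:
  fixes q r :: "'y::metric_space"
  assumes Y: "hadamard_space TYPE('y)" and l: "0 \<le> l" "l \<le> 1"
  obtains m where "cat0_point q r l m"
proof -
  obtain c where c: "geodesic_curve c q r"
    using Y unfolding hadamard_space_def by blast
  then have rc: "rectifiable_curve c 0 1" "c 0 = q" "c 1 = r" "curve_length c 0 1 = dist q r"
    unfolding geodesic_curve_def by auto
  have "continuous_on {0..1} (\<lambda>s. dist (c s) q)"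
    using rc(1) unfolding rectifiable_curve_def by (intro continuous_intros) auto
  moreover have "dist (c 0) q \<le> l * dist q r" "l * dist q r \<le> dist (c 1) q"
    using l rc by (auto simp: dist_commute mult_left_le_one_le)
  ultimately obtain s where s: "0 \<le> s" "s \<le> 1" "dist (c s) q = l * dist q r"
    using IVT'[of "\<lambda>s. dist (c s) q" 0 "l * dist q r" 1] by auto
  have "dist q (c s) + dist (c s) r \<le> dist q r"
    using dist_le_curve_length[OF rc(1), of s s] s rc by simp
  then have "dist (c s) r = (1 - l) * dist q r"
    using s(3) dist_triangle[of q r "c s"] by (simp add: dist_commute algebra_simps)
  moreover have "(dist p (c s))\<^sup>2 \<le> (1 - l) * (dist p q)\<^sup>2 + l * (dist p r)\<^sup>2 - l * (1 - l) * (dist q r)\<^sup>2" for p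
    using Y c s l unfolding hadamard_space_def by auto
  ultimately show ?thesis
    using that s(3) unfolding cat0_point_def by blast
qed

lemma cat0_point_sym: "cat0_point q r l m \<Longrightarrow> cat0_point r q (1 - l) m"
  unfolding cat0_point_def by (simp add: dist_commute algebra_simps)

text \<open>Surjectivity writes an arbitrary test point as \<open>f p'\<close>, where the original
  inequality applies.\<close>

lemma cat0_point_isometry:
  assumes "cat0_point q r l m" "\<And>x y. dist (f x) (f y) = dist x y" "surj f"
  shows "cat0_point (f q) (f r) l (f m)"
proof -
  have "(dist p (f m))\<^sup>2 \<le> (1 - l) * (dist p (f q))\<^sup>2 + l * (dist p (f r))\<^sup>2 - l * (1 - l) * (dist q r)\<^sup>2" for p
  proof -
    obtain p' where "p = f p'" using assms(3) by (metis surjD)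
    then show ?thesis using assms(1,2) unfolding cat0_point_def by simp
  qed
  then show ?thesis using assms(1,2) unfolding cat0_point_def by simp
qed

text \<open>Test the inequality for \<open>m\<close> against \<open>n\<close>, and the one for
  \<open>n\<close> against \<open>r\<close>. After substitution all terms in \<open>dist q r\<close>
  and \<open>dist q r'\<close> cancel, leaving an exact square.\<close>

lemma cat0_point_common_start:
  assumes m: "cat0_point q r l m" and n: "cat0_point q r' l n" and l: "0 \<le> l" "l \<le> 1"
  shows "dist m n \<le> l * dist r r'"
proof -
  have 1: "(dist n m)\<^sup>2 \<le> (1 - l) * (dist n q)\<^sup>2 + l * (dist n r)\<^sup>2 - l * (1 - l) * (dist q r)\<^sup>2"
    and 2: "(dist r n)\<^sup>2 \<le> (1 - l) * (dist r q)\<^sup>2 + l * (dist r r')\<^sup>2 - l * (1 - l) * (dist q r')\<^sup>2"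
    and 3: "dist n q = l * dist q r'"
    using m n unfolding cat0_point_def by blast+
  have "(dist m n)\<^sup>2 \<le> (1 - l) * (l * dist q r')\<^sup>2
      + l * ((1 - l) * (dist q r)\<^sup>2 + l * (dist r r')\<^sup>2 - l * (1 - l) * (dist q r')\<^sup>2)
      - l * (1 - l) * (dist q r)\<^sup>2"
    using 1 mult_left_mono[OF 2 l(1)]
    unfolding 3 dist_commute[of n m] dist_commute[of n r] dist_commute[of r q] by linarith
  also have "\<dots> = (l * dist r r')\<^sup>2"
    by (simp add: power2_eq_square algebra_simps)
  finally show ?thesis
    by (rule power2_le_imp_le) (simp add: l)
qed

text \<open>The diagonal from \<open>q\<close> to \<open>r'\<close> splits the quadrilateral into
  two triangles, each with a common starting point; the second one is read backwards.\<close>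

lemma cat0_point_convex:
  fixes q r q' r' :: "'y::metric_space"
  assumes Y: "hadamard_space TYPE('y)"
    and m: "cat0_point q r l m" and n: "cat0_point q' r' l n" and l: "0 \<le> l" "l \<le> 1"
  shows "dist m n \<le> (1 - l) * dist q q' + l * dist r r'"
proof -
  obtain k where k: "cat0_point q r' l k"
    using cat0_point_exists[OF Y l] .
  have "dist m k \<le> l * dist r r'"
    using cat0_point_common_start[OF m k l] .
  moreover have "dist k n \<le> (1 - l) * dist q q'"
    using cat0_point_common_start[OF cat0_point_sym[OF k] cat0_point_sym[OF n]] l by simp
  ultimately show ?thesis
    using dist_triangle[of m n k] by linarith
qed

subsection \<open>Growth of the displacement\<close>

locale geometric_action = group L for L :: "('l, 'm) monoid_scheme" (structure) +
  fixes act :: "'l \<Rightarrow> 'y::metric_space \<Rightarrow> 'y"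
  assumes hadamard: "hadamard_space TYPE('y)"
    and locally_compact: "locally_compact_space TYPE('y)"
    and isometric: "isometric_action L act"
    and proper: "proper_action L act"
    and cocompact: "cocompact_action L act"
begin

lemma act_one [simp]: "act \<one> x = x"
  and act_mult: "g \<in> carrier L \<Longrightarrow> h \<in> carrier L \<Longrightarrow> act (g \<otimes> h) x = act g (act h x)"
  and act_dist [simp]: "g \<in> carrier L \<Longrightarrow> dist (act g x) (act g y) = dist x y"
  using isometric unfolding isometric_action_def by auto

lemma act_inv [simp]:
  "g \<in> carrier L \<Longrightarrow> act (inv g) (act g x) = x"
  "g \<in> carrier L \<Longrightarrow> act g (act (inv g) x) = x"
  by (simp_all flip: act_mult)

lemma act_dist_inv: "g \<in> carrier L \<Longrightarrow> dist x (act (inv g) y) = dist (act g x) y"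
  by (metis act_dist act_inv(2))

lemma act_image_cball: "g \<in> carrier L \<Longrightarrow> act g ` cball x r = cball (act g x) r"
proof (intro equalityI subsetI)
  fix y assume "g \<in> carrier L" "y \<in> cball (act g x) r"
  then show "y \<in> act g ` cball x r"
    by (intro image_eqI[of _ _ "act (inv g) y"]) (auto simp: act_dist_inv)
qed auto

lemma continuous_act: "g \<in> carrier L \<Longrightarrow> continuous_on A (act g)"
  by (force simp: continuous_on_iff)

section \<open>Co-compactness, compact balls and local finiteness\<close>

text \<open>The saturations of balls under the action are open and invariant, so co-compactness
  applies to them. The radius may vary with the centre.\<close>

lemma finite_ball_cover:
  assumes "\<And>y::'y. r y > 0"
  obtains F where "finite F" "\<And>z. \<exists>y\<in>F. \<exists>g\<in>carrier L. dist (act g z) y < r y"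
proof -
  define U where "U y = {z. \<exists>g\<in>carrier L. dist (act g z) y < r y}" for y
  have "U y = (\<Union>g\<in>carrier L. act g -` ball y (r y))" for y
    by (auto simp: U_def dist_commute)
  then have "open (U y)" for y
    by (auto intro!: open_vimage continuous_act)
  moreover have "invariant_set L act (U y)" for y
  proof -
    have "act k z \<in> U y" if k: "k \<in> carrier L" and z: "z \<in> U y" for k z
    proof -
      obtain g where "g \<in> carrier L" "dist (act g z) y < r y" using z by (auto simp: U_def)
      then show ?thesis
        unfolding U_def using k by (auto simp: act_mult intro!: bexI[of _ "g \<otimes> inv k"])
    qed
    then show ?thesis by (auto simp: invariant_set_def)
  qed
  moreover have "\<Union> (range U) = UNIV"
    using assms by (force simp: U_def intro!: bexI[of _ \<one>])
  ultimately obtain \<F> where "\<F> \<subseteq> range U" "finite \<F>" "\<Union>\<F> = UNIV"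
    using cocompact unfolding cocompact_action_def by (metis (no_types, lifting) imageE)
  then obtain F where "finite F" "\<Union> (U ` F) = UNIV"
    by (metis finite_subset_image)
  then show ?thesis
    using that[of F] unfolding U_def by blast
qed

text \<open>Finitely many unit balls meeting every orbit fit into one ball about \<open>x\<close>,
  which serves as a coarse fundamental domain.\<close>

lemma bounded_orbit_representatives:
  obtains R where "R \<ge> 0" "\<And>z. \<exists>g\<in>carrier L. dist (act g z) x \<le> R"
proof -
  obtain F where F: "finite F" "\<And>z. \<exists>y\<in>F. \<exists>g\<in>carrier L. dist (act g z) y < 1"
    using finite_ball_cover[of "\<lambda>_. 1"] by auto
  define R where "R = 1 + (\<Sum>y\<in>F. dist y x)"
  have "\<exists>g\<in>carrier L. dist (act g z) x \<le> R" for z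
  proof -
    obtain y g where *: "y \<in> F" "g \<in> carrier L" "dist (act g z) y < 1"
      using F(2) by blast
    moreover have "dist y x \<le> (\<Sum>y\<in>F. dist y x)"
      using F(1) * by (intro member_le_sum) auto
    ultimately show ?thesis
      unfolding R_def using dist_triangle[of "act g z" x y] by (intro bexI[of _ g]) auto
  qed
  moreover have "R \<ge> 0"
    unfolding R_def by (simp add: sum_nonneg add_nonneg_nonneg)
  ultimately show ?thesis using that by blast
qed

text \<open>Local compactness gives a radius at each point; co-compactness reduces these to finitely
  many, and isometries carry compactness back.\<close>

lemma uniform_compact_cball:
  obtains r where "r > 0" "\<And>x::'y. compact (cball x r)"
proof -
  \<comment> \<open>The factor 2 leaves room: a ball of radius \<open>r\<close> about a point within
    \<open>r\<close> of \<open>y\<close> stays inside the compact ball.\<close>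
  have "\<exists>r>0. compact (cball y (2 * r))" for y :: 'y
  proof -
    obtain U K where UK: "open U" "compact K" "y \<in> U" "U \<subseteq> K"
      using locally_compact unfolding locally_compact_space_def by blast
    then obtain e where "e > 0" "cball y e \<subseteq> U"
      by (meson open_contains_cball)
    then have "compact (cball y e)"
      using UK by (metis closed_cball compact_Int_closed inf.absorb_iff2 subset_trans)
    then show ?thesis using \<open>e > 0\<close> by (intro exI[of _ "e / 2"]) auto
  qed
  then obtain \<rho> where \<rho>: "\<And>y::'y. \<rho> y > 0" "\<And>y. compact (cball y (2 * \<rho> y))"
    by metis
  obtain F where F: "finite F" "\<And>z. \<exists>y\<in>F. \<exists>g\<in>carrier L. dist (act g z) y < \<rho> y"
    using finite_ball_cover[of \<rho>] \<rho>(1) by auto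
  define r where "r = Min (\<rho> ` F)"
  have "F \<noteq> {}" using F(2) by blast
  then have "r > 0" unfolding r_def using F(1) \<rho>(1) by auto
  moreover have "compact (cball x r)" for x :: 'y
  proof -
    obtain y g where *: "y \<in> F" "g \<in> carrier L" "dist (act g x) y < \<rho> y"
      using F(2) by blast
    have "r \<le> \<rho> y" using F(1) * by (auto simp: r_def)
    have "cball (act g x) r \<subseteq> cball y (2 * \<rho> y)"
    proof
      fix z assume "z \<in> cball (act g x) r"
      then show "z \<in> cball y (2 * \<rho> y)"
        using * \<open>r \<le> \<rho> y\<close> dist_triangle[of y z "act g x"] by (auto simp: dist_commute)
    qed
    then have "compact (cball (act g x) r)"
      using \<rho>(2) by (metis closed_cball compact_Int_closed inf.absorb_iff2)
    then have "compact (act (inv g) ` cball (act g x) r)"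
      using * by (intro compact_continuous_image continuous_act) auto
    then show ?thesis using * by (simp add: act_image_cball)
  qed
  ultimately show ?thesis using that by blast
qed

text \<open>A Hopf-Rinow argument: the radius grows by \<open>r / 2\<close> at a time. A finite
  \<open>r / 2\<close>-net of the old ball is an \<open>r\<close>-net of the new one, and balls of
  radius \<open>r\<close> are compact.\<close>

lemma compact_cball_Y: "compact (cball (x::'y) R)"
proof -
  obtain r where r: "r > 0" "\<And>x::'y. compact (cball x r)"
    using uniform_compact_cball by blast
  have "compact (cball x (real n * (r / 2)))" for n
  proof (induction n)
    case 0
    then show ?case by simp
  next
    case (Suc n)
    let ?t = "real n * (r / 2)"
    obtain F where F: "finite F" "cball x ?t \<subseteq> (\<Union>y\<in>F. ball y (r / 2))"
    proof -
      have "cball x ?t \<subseteq> (\<Union>y\<in>cball x ?t. ball y (r / 2))" using r(1) by force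
      then show ?thesis
        using that compactE_image[OF Suc, of "cball x ?t" "\<lambda>y. ball y (r / 2)"]
        by (metis open_ball)
    qed
    have "cball x (real (Suc n) * (r / 2)) \<subseteq> (\<Union>y\<in>F. cball y r)"
    proof
      fix z assume "z \<in> cball x (real (Suc n) * (r / 2))"
      then have z: "dist x z \<le> ?t + r / 2" by (simp add: algebra_simps add_divide_distrib)
      obtain m where m: "dist x m \<le> ?t" "dist m z \<le> r / 2"
      proof (cases "dist x z \<le> ?t")
        case True
        then show ?thesis using that[of z] r by auto
      next
        case False
        \<comment> \<open>This fraction puts \<open>m\<close> on the geodesic at distance exactly
          \<open>?t\<close> from \<open>x\<close>, hence within \<open>r / 2\<close> of
          \<open>z\<close>.\<close>
        define l where "l = ?t / dist x z"
        have "?t \<ge> 0" using r(1) by simp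
        then have pos: "dist x z > 0" "?t \<ge> 0" using False by linarith+
        then have l: "0 \<le> l" "l \<le> 1" "l * dist x z = ?t"
          using False by (auto simp: l_def field_simps)
        obtain m where "cat0_point x z l m" using cat0_point_exists[OF hadamard l(1,2)] .
        then show ?thesis
          using that[of m] l z unfolding cat0_point_def by (simp add: dist_commute left_diff_distrib)
      qed
      then obtain y where "y \<in> F" "dist y m < r / 2" using F(2) by force
      then show "z \<in> (\<Union>y\<in>F. cball y r)"
        using m dist_triangle[of y z m] by force
    qed
    moreover have "compact (\<Union>y\<in>F. cball y r)" using F(1) r(2) by blast
    ultimately show ?case by (metis closed_cball compact_Int_closed inf.absorb_iff2)
  qed
  moreover obtain n where "R / (r / 2) < real n" using reals_Archimedean2 by blast
  then have "cball x R \<subseteq> cball x (real n * (r / 2))" using r(1) by (auto simp: field_simps)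
  ultimately show ?thesis by (metis closed_cball compact_Int_closed inf.absorb_iff2)
qed

text \<open>Properness makes the orbit of \<open>x\<close> locally finite, counted with
  multiplicity, near every point; compactness of \<open>cball x c\<close> makes this finite in
  total.\<close>

lemma finite_bounded_displacement: "finite {g \<in> carrier L. dist x (act g x) \<le> c}"
proof -
  have "\<exists>r>0. finite {g \<in> carrier L. act g x \<in> ball y r}" for y
  proof -
    obtain r where r: "r > 0" "finite {g \<in> carrier L. act g ` ball y r \<inter> ball y r \<noteq> {}}"
      using proper unfolding proper_action_def by blast
    have "finite {g \<in> carrier L. act g x \<in> ball y r}"
    proof (cases "\<exists>k\<in>carrier L. act k x \<in> ball y r")
      case True
      then obtain k where k: "k \<in> carrier L" "act k x \<in> ball y r" by blast
      \<comment> \<open>Properness speaks of elements moving the ball at \<open>y\<close> onto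
        itself in part. With \<open>k\<close> fixed, \<open>g \<otimes> inv k\<close> is such an
        element, as it sends \<open>act k x\<close> to \<open>act g x\<close>.\<close>
      have "{g \<in> carrier L. act g x \<in> ball y r}
          \<subseteq> (\<lambda>g. g \<otimes> k) ` {g \<in> carrier L. act g ` ball y r \<inter> ball y r \<noteq> {}}"
      proof
        fix g assume "g \<in> {g \<in> carrier L. act g x \<in> ball y r}"
        then have g: "g \<in> carrier L" "act g x \<in> ball y r" by auto
        have "act (g \<otimes> inv k) (act k x) = act g x" using g k by (simp add: act_mult)
        then have "act (g \<otimes> inv k) ` ball y r \<inter> ball y r \<noteq> {}"
          using g k by (metis disjoint_iff image_eqI)
        moreover have "g = (g \<otimes> inv k) \<otimes> k" using g k by (simp add: m_assoc)
        ultimately show "g \<in> (\<lambda>g. g \<otimes> k) ` {g \<in> carrier L. act g ` ball y r \<inter> ball y r \<noteq> {}}"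
          using g k by blast
      qed
      then show ?thesis using r(2) by (meson finite_imageI finite_subset)
    next
      case False
      then have "{g \<in> carrier L. act g x \<in> ball y r} = {}" by blast
      then show ?thesis by (metis finite.emptyI)
    qed
    then show ?thesis using r(1) by blast
  qed
  then obtain \<rho> where \<rho>: "\<And>y. \<rho> y > 0" "\<And>y. finite {g \<in> carrier L. act g x \<in> ball y (\<rho> y)}"
    by metis
  have "cball x c \<subseteq> (\<Union>y\<in>cball x c. ball y (\<rho> y))" using \<rho>(1) by force
  then obtain F where F: "finite F" "cball x c \<subseteq> (\<Union>y\<in>F. ball y (\<rho> y))"
    using compactE_image[OF compact_cball_Y[of x c], of "cball x c" "\<lambda>y. ball y (\<rho> y)"]
    by (metis open_ball)
  then have "{g \<in> carrier L. dist x (act g x) \<le> c} \<subseteq> (\<Union>y\<in>F. {g \<in> carrier L. act g x \<in> ball y (\<rho> y)})"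
    by force
  then show ?thesis using F(1) \<rho>(2) by (meson finite_UN finite_subset)
qed

section \<open>Commutants of finite sets and the displacement\<close>

definition commutant :: "'l set \<Rightarrow> 'l set" where
  "commutant S = {z \<in> carrier L. \<forall>s\<in>S. z \<otimes> s = s \<otimes> z}"

text \<open>Lets the orbit elements found separately for \<open>u\<close> and \<open>v\<close> be
  combined into one \<open>h\<close>.\<close>

lemma commutant_mult_inv:
  assumes "S \<subseteq> carrier L" "h \<in> commutant S" "k \<in> commutant S"
  shows "h \<otimes> inv k \<in> commutant S"
proof -
  have "(h \<otimes> inv k) \<otimes> s = s \<otimes> (h \<otimes> inv k)" if s: "s \<in> S" for s
  proof -
    have c: "h \<in> carrier L" "k \<in> carrier L" "s \<in> carrier L"
      and hs: "h \<otimes> s = s \<otimes> h" and ks: "k \<otimes> s = s \<otimes> k"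
      using assms s by (auto simp: commutant_def)
    have "inv k \<otimes> s = inv k \<otimes> (s \<otimes> k) \<otimes> inv k" using c by (simp add: m_assoc)
    also have "\<dots> = s \<otimes> inv k" using c by (simp add: m_assoc[symmetric] flip: ks)
    finally have "inv k \<otimes> s = s \<otimes> inv k" .
    then show ?thesis using c hs by (metis inv_closed m_assoc)
  qed
  then show ?thesis using assms by (auto simp: commutant_def)
qed

text \<open>Two conjugators with the same effect on \<open>S\<close> differ by an element of the commutant.\<close>

lemma displacement_sublevel_cobounded:
  assumes S: "finite S" "S \<subseteq> carrier L"
  obtains R where "R \<ge> 0"
    "\<And>y. (\<And>s. s \<in> S \<Longrightarrow> dist y (act s y) \<le> c) \<Longrightarrow> \<exists>h\<in>commutant S. dist y (act h x) \<le> R"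
proof -
  obtain R0 where R0: "R0 \<ge> 0" "\<And>z. \<exists>g\<in>carrier L. dist (act g z) x \<le> R0"
    using bounded_orbit_representatives[of x] by blast
  \<comment> \<open>A conjugate \<open>a \<otimes> s \<otimes> inv a\<close> moves
    \<open>act a y\<close> by at most \<open>c\<close>, and \<open>x\<close> is within
    \<open>R0\<close> of that point: hence \<open>2 * R0 + c\<close>.\<close>
  define B where "B = {g \<in> carrier L. dist x (act g x) \<le> 2 * R0 + c}"
  \<comment> \<open>Restriction to \<open>S\<close> makes \<open>T a\<close> an element of the
    finite extensional function space from \<open>S\<close> to \<open>B\<close>.\<close>
  define T where "T a = restrict (\<lambda>s. a \<otimes> s \<otimes> inv a) S" for a
  define M where "M = {a \<in> carrier L. T a \<in> S \<rightarrow>\<^sub>E B}"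
  have "finite (S \<rightarrow>\<^sub>E B)"
    using S(1) finite_bounded_displacement by (auto simp: B_def intro: finite_PiE)
  then have "finite (T ` M)" by (rule finite_subset[rotated]) (auto simp: M_def)
  then obtain M0 where M0: "finite M0" "M0 \<subseteq> M" "T ` M0 = T ` M"
    by (metis finite_subset_image subset_refl)
  define R where "R = R0 + (\<Sum>a\<in>M0. dist x (act a x))"
  have "\<exists>h\<in>commutant S. dist y (act h x) \<le> R"
    if y: "\<And>s. s \<in> S \<Longrightarrow> dist y (act s y) \<le> c" for y
  proof -
    obtain a where a: "a \<in> carrier L" "dist (act a y) x \<le> R0" using R0(2) by blast
    have "a \<otimes> s \<otimes> inv a \<in> B" if s: "s \<in> S" for s
    proof -
      let ?k = "a \<otimes> s \<otimes> inv a"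
      have s': "s \<in> carrier L" using s S by blast
      then have k: "?k \<in> carrier L" "act ?k (act a y) = act a (act s y)"
        using a by (auto simp: act_mult)
      have "dist x (act ?k x) \<le> dist x (act a y) + dist (act a y) (act ?k (act a y))
          + dist (act ?k (act a y)) (act ?k x)"
        using dist_triangle[of x "act ?k x" "act a y"]
          dist_triangle[of "act a y" "act ?k x" "act ?k (act a y)"] by linarith
      also have "\<dots> \<le> R0 + c + R0"
      proof (intro add_mono)
        show "dist x (act a y) \<le> R0" using a by (simp add: dist_commute)
        show "dist (act a y) (act ?k (act a y)) \<le> c" using k(2) a y[OF s] by simp
        show "dist (act ?k (act a y)) (act ?k x) \<le> R0"
          using act_dist[OF k(1), of "act a y" x] a by simp
      qed
      finally show ?thesis using k by (simp add: B_def)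
    qed
    then have "T a \<in> S \<rightarrow>\<^sub>E B" by (auto simp: T_def)
    then have "T a \<in> T ` M0" using M0(3) a by (auto simp: M_def)
    then obtain b where b: "b \<in> M0" "T b = T a" by (metis imageE)
    then have b': "b \<in> carrier L" using M0 by (auto simp: M_def)
    have "inv a \<otimes> b \<otimes> s = s \<otimes> (inv a \<otimes> b)" if s: "s \<in> S" for s
    proof -
      have c: "a \<in> carrier L" "b \<in> carrier L" "s \<in> carrier L" using a b' s S by auto
      have "b \<otimes> s \<otimes> inv b = a \<otimes> s \<otimes> inv a"
        using b(2) s by (auto simp: T_def dest: fun_cong[of _ _ s])
      then have "inv a \<otimes> (b \<otimes> s \<otimes> inv b) \<otimes> b = inv a \<otimes> (a \<otimes> s \<otimes> inv a) \<otimes> b" by simp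
      moreover have "inv a \<otimes> (b \<otimes> s \<otimes> inv b) \<otimes> b = inv a \<otimes> b \<otimes> s"
        using c by (simp add: m_assoc)
      moreover have "inv a \<otimes> (a \<otimes> s \<otimes> inv a) \<otimes> b = s \<otimes> (inv a \<otimes> b)"
        using c by (simp add: m_assoc[symmetric])
      ultimately show ?thesis by simp
    qed
    then have "inv a \<otimes> b \<in> commutant S" using a b' by (auto simp: commutant_def)
    moreover have "dist y (act (inv a \<otimes> b) x) \<le> R"
    proof -
      have "dist y (act (inv a \<otimes> b) x) = dist (act a y) (act b x)"
        using a b' by (simp add: act_mult act_dist_inv)
      also have "\<dots> \<le> dist (act a y) x + dist x (act b x)" by (rule dist_triangle)
      also have "dist x (act b x) \<le> (\<Sum>a\<in>M0. dist x (act a x))"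
        using M0(1) b(1) by (intro member_le_sum) auto
      finally show ?thesis using a by (simp add: R_def)
    qed
    ultimately show ?thesis by blast
  qed
  moreover have "R \<ge> 0" using R0(1) by (simp add: R_def sum_nonneg)
  ultimately show ?thesis using that by blast
qed

text \<open>Follow the geodesic from an almost nearest point of the commutant orbit towards \<open>p\<close>: just outside
  the cobounded sublevel set the displacement has grown by at least 1, and by convexity it keeps
  growing at this linear rate.\<close>

lemma dist_commutant_orbit_le_displacement:
  assumes S: "finite S" "S \<subseteq> carrier L"
  obtains A where "A \<ge> 0"
    "\<And>p D. D \<ge> 0 \<Longrightarrow> (\<And>s. s \<in> S \<Longrightarrow> dist p (act s p) \<le> D) \<Longrightarrow>
      \<exists>h\<in>commutant S. dist p (act h x) \<le> A * D + A"
proof -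
  define c where "c = (\<Sum>s\<in>S. dist x (act s x))"
  have c: "c \<ge> 0" "\<And>s. s \<in> S \<Longrightarrow> dist x (act s x) \<le> c"
    unfolding c_def using S(1) by (auto intro: sum_nonneg member_le_sum)
  obtain R where R: "R \<ge> 0"
    "\<And>y. (\<And>s. s \<in> S \<Longrightarrow> dist y (act s y) \<le> c + 1) \<Longrightarrow> \<exists>h\<in>commutant S. dist y (act h x) \<le> R"
    using displacement_sublevel_cobounded[OF S, of "c + 1" x] by blast
  have "\<exists>h\<in>commutant S. dist p (act h x) \<le> (R + 2) * D + (R + 2)"
    if D: "D \<ge> 0" and p: "\<And>s. s \<in> S \<Longrightarrow> dist p (act s p) \<le> D" for p D
  proof -
    \<comment> \<open>The infimum need not be attained, so \<open>h\<close> below is only optimal up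
      to 1.\<close>
    define I where "I = (INF h\<in>commutant S. dist p (act h x))"
    have ne: "commutant S \<noteq> {}" using S by (auto simp: commutant_def intro!: exI[of _ \<one>])
    have bdd: "bdd_below ((\<lambda>h. dist p (act h x)) ` commutant S)" by (rule bdd_belowI2[of _ 0]) simp
    have I_le: "I \<le> dist p (act h x)" if "h \<in> commutant S" for h
      unfolding I_def using bdd that by (rule cINF_lower)
    obtain h where h: "h \<in> commutant S" "dist p (act h x) < I + 1"
      using cINF_less_iff[OF ne bdd, of "I + 1"] by (auto simp: I_def)
    have hc: "h \<in> carrier L" using h(1) by (simp add: commutant_def)
    define d where "d = dist (act h x) p"
    have "d \<le> (R + 2) * D + (R + 2)"
    proof (cases "d \<le> R + 2")
      case True
      then show ?thesis using R(1) D by (simp add: add_increasing)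
    next
      case False
      \<comment> \<open>Places \<open>m\<close> at distance \<open>R + 2\<close> from
        \<open>act h x\<close>. The margin over \<open>R\<close> absorbs the error 1 in the choice
        of \<open>h\<close>.\<close>
      define l where "l = (R + 2) / d"
      have l: "0 \<le> l" "l \<le> 1" "l * d = R + 2" using False R(1) by (auto simp: l_def field_simps)
      obtain m where m: "cat0_point (act h x) p l m" using cat0_point_exists[OF hadamard l(1,2)] .
      have mp: "dist m p = d - (R + 2)"
        using m l(3) unfolding cat0_point_def d_def by (simp add: algebra_simps)
      \<comment> \<open>Orbit points are farther than \<open>d - 1\<close> from \<open>p\<close>,
        while \<open>m\<close> is at distance \<open>d - (R + 2)\<close>. So \<open>m\<close> lies
        outside the sublevel set for \<open>c + 1\<close>.\<close>
      have "R < dist m (act k x)" if "k \<in> commutant S" for k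
        using I_le[OF that] dist_triangle[of p "act k x" m] mp h(2)
        by (simp add: dist_commute d_def)
      then obtain s where s: "s \<in> S" "c + 1 < dist m (act s m)"
        using R(2)[of m] by (meson linorder_not_le)
      have sc: "s \<in> carrier L" using s S by blast
      have "surj (act s)" using sc by (metis act_inv(2) surjI)
      then have "cat0_point (act s (act h x)) (act s p) l (act s m)"
        by (intro cat0_point_isometry[OF m]) (simp_all add: sc)
      from cat0_point_convex[OF hadamard m this l(1,2)]
      have "dist m (act s m) \<le> (1 - l) * dist (act h x) (act s (act h x)) + l * dist p (act s p)" .
      \<comment> \<open>Displacement is constant on the orbit of the commutant, so at the start of
        the geodesic it is still at most \<open>c\<close>.\<close>
      also have "dist (act h x) (act s (act h x)) = dist x (act s x)"
      proof -
        have "h \<otimes> s = s \<otimes> h" using h(1) s(1) by (simp add: commutant_def)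
        then have "act s (act h x) = act h (act s x)"
          using hc sc act_mult[of s h x] act_mult[of h s x] by simp
        then show ?thesis using hc by simp
      qed
      also have "(1 - l) * dist x (act s x) + l * dist p (act s p) \<le> (1 - l) * c + l * D"
        using l c(2) p s by (intro add_mono mult_left_mono) auto
      also have "\<dots> \<le> c + l * D" using l c by (simp add: algebra_simps)
      finally have "1 \<le> l * D" using s(2) by simp
      then have "d \<le> (R + 2) * D" using False R(1) by (simp add: l_def field_simps)
      then show ?thesis using R(1) by simp
    qed
    then show ?thesis using h(1) by (auto simp: d_def dist_commute)
  qed
  then show ?thesis using that[of "R + 2"] R(1) by simp
qed

end

subsection \<open>Reduced words and edge paths\<close>

lemma oflip_oflip [simp]: "oflip (oflip x) = x"
  by (cases x) simp

lemma otail_oflip [simp]: "otail src tgt (oflip x) = ohead src tgt x"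
  and ohead_oflip [simp]: "ohead src tgt (oflip x) = otail src tgt x"
  and fst_oflip [simp]: "fst (oflip x) = fst x"
  by (cases x; simp)+

lemma reduce_Nil [simp]: "reduce [] = []"
  and reduce_Cons: "reduce (x # xs) = red_step x (reduce xs)"
  and reduce_append: "reduce (xs @ ys) = foldr red_step xs (reduce ys)"
  by (simp_all add: reduce_def)

lemma reduced_ConsD: "reduced (x # xs) \<Longrightarrow> reduced xs"
  by (cases xs) auto

lemma reduced_red_step: "reduced ys \<Longrightarrow> reduced (red_step x ys)"
  by (cases ys) (auto simp: red_step_def dest: reduced_ConsD)

lemma reduced_foldr_red_step: "reduced ys \<Longrightarrow> reduced (foldr red_step xs ys)"
  by (induction xs) (auto intro: reduced_red_step)

lemma reduced_reduce [simp]: "reduced (reduce xs)"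
  unfolding reduce_def by (rule reduced_foldr_red_step) simp

lemma reduce_reduced: "reduced xs \<Longrightarrow> reduce xs = xs"
proof (induction xs)
  case (Cons x xs)
  then have "reduce xs = xs" by (blast dest: reduced_ConsD)
  then show ?case using Cons.prems by (cases xs) (auto simp: reduce_Cons red_step_def)
qed simp

text \<open>If \<open>ys\<close> begins with \<open>x\<close>, the inner step deletes it, and
  reducedness keeps the outer step from cancelling again.\<close>

lemma red_step_cancel: "reduced ys \<Longrightarrow> red_step x (red_step (oflip x) ys) = ys"
  by (cases ys rule: reduced.cases) (auto simp: red_step_def)

text \<open>Letters act on reduced words by mutually inverse permutations, so cancelling a pair does
  not change the action of a word. This yields associativity of the product on reduced
  words.\<close>

lemma foldr_red_step_reduce:
  assumes "reduced ys"
  shows "foldr red_step (reduce xs) ys = foldr red_step xs ys"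
proof (induction xs)
  case (Cons x xs)
  show ?case
  proof (cases "\<exists>r. reduce xs = oflip x # r")
    case True
    then obtain r where r: "reduce xs = oflip x # r" by blast
    then have "foldr red_step (x # xs) ys = red_step x (red_step (oflip x) (foldr red_step r ys))"
      using Cons.IH by simp
    also have "\<dots> = foldr red_step r ys"
      by (intro red_step_cancel reduced_foldr_red_step assms)
    also have "r = reduce (x # xs)" using r by (simp add: reduce_Cons red_step_def)
    finally show ?thesis by (rule sym)
  next
    case False
    then have "reduce (x # xs) = x # reduce xs"
      by (cases "reduce xs") (auto simp: reduce_Cons red_step_def)
    then show ?thesis using Cons.IH by simp
  qed
qed simp

lemma reduce_append_reduce_left [simp]: "reduce (reduce xs @ ys) = reduce (xs @ ys)"
  by (simp add: reduce_append foldr_red_step_reduce)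

lemma reduce_append_reduce_right [simp]: "reduce (xs @ reduce ys) = reduce (xs @ ys)"
  by (simp add: reduce_append reduce_reduced)

definition word_inv :: "('e \<times> bool) list \<Rightarrow> ('e \<times> bool) list" where
  "word_inv p = rev (map oflip p)"

lemma word_inv_word_inv [simp]: "word_inv (word_inv p) = p"
  by (simp add: word_inv_def rev_map comp_def)

lemma foldr_word_inv_cancel:
  "reduced ys \<Longrightarrow> foldr red_step (word_inv p) (foldr red_step p ys) = ys"
proof (induction p arbitrary: ys)
  case (Cons x p)
  have "red_step (oflip x) (red_step x (foldr red_step p ys)) = foldr red_step p ys"
    using red_step_cancel[of "foldr red_step p ys" "oflip x"] reduced_foldr_red_step[OF Cons.prems]
    by simp
  then show ?case using Cons by (simp add: word_inv_def)
qed (simp add: word_inv_def)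

lemma reduce_word_inv_cancel [simp]:
  "reduce (xs @ word_inv p @ p @ ys) = reduce (xs @ ys)"
  "reduce (xs @ p @ word_inv p @ ys) = reduce (xs @ ys)"
  using foldr_word_inv_cancel[of "reduce ys" p] foldr_word_inv_cancel[of "reduce ys" "word_inv p"]
  by (simp_all add: reduce_append)

lemma is_path_append:
  "is_path E src tgt v w (p @ q) \<longleftrightarrow> (\<exists>m. is_path E src tgt v m p \<and> is_path E src tgt m w q)"
  by (induction p arbitrary: v) auto

lemma is_path_word_inv:
  "is_path E src tgt v w p \<Longrightarrow> is_path E src tgt w v (word_inv p)"
  by (induction p arbitrary: v) (auto simp: word_inv_def is_path_append)

lemma is_path_red_step:
  assumes "fst x \<in> E" "is_path E src tgt (ohead src tgt x) w ys"
  shows "is_path E src tgt (otail src tgt x) w (red_step x ys)"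
  using assms by (cases ys) (auto simp: red_step_def)

lemma is_path_reduce: "is_path E src tgt v w p \<Longrightarrow> is_path E src tgt v w (reduce p)"
  by (induction p arbitrary: v) (auto simp: reduce_Cons intro: is_path_red_step)

subsection \<open>Generators of the fundamental group\<close>

locale graph_representation = geometric_action L act
  for L :: "('l, 'm) monoid_scheme" (structure) and act :: "'l \<Rightarrow> 'y::metric_space \<Rightarrow> 'y" +
  fixes V :: "'v set" and E :: "'e set" and src tgt :: "'e \<Rightarrow> 'v" and len :: "'e \<Rightarrow> real"
    and v0 :: 'v and \<rho> :: "('e \<times> bool) list \<Rightarrow> 'l"
  assumes graph: "metric_graph V E src tgt len"
    and conn: "connected_graph V E src tgt"
    and v0: "v0 \<in> V"
    and rho_carrier: "\<rho> ` fund_group E src tgt v0 \<subseteq> carrier L"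
    and rho_hom: "\<forall>g\<in>fund_group E src tgt v0. \<forall>h\<in>fund_group E src tgt v0.
                    \<rho> (reduce (g @ h)) = \<rho> g \<otimes> \<rho> h"
begin

abbreviation "epath \<equiv> is_path E src tgt"
abbreviation "\<Gamma> \<equiv> fund_group E src tgt v0"
abbreviation "lift \<equiv> lift_vertex E src tgt v0"
abbreviation "tl_v \<equiv> otail src tgt"
abbreviation "hd_v \<equiv> ohead src tgt"
abbreviation "pt \<equiv> tree_point E src tgt len v0"

lemma finite_V: "finite V" and finite_E: "finite E"
  using graph by (auto simp: metric_graph_def)

lemma endpoints_in_V: "fst oe \<in> E \<Longrightarrow> tl_v oe \<in> V" "fst oe \<in> E \<Longrightarrow> hd_v oe \<in> V"
  using graph by (cases oe; simp add: metric_graph_def)+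

lemma path_lift: "w \<in> V \<Longrightarrow> epath v0 w (lift w)"
  and reduced_lift: "w \<in> V \<Longrightarrow> reduced (lift w)"
proof -
  assume "w \<in> V"
  then obtain p where "epath v0 w p"
    using conn v0 unfolding connected_graph_def by blast
  then have "epath v0 w (reduce p) \<and> reduced (reduce p)"
    by (simp add: is_path_reduce)
  then have "\<exists>p. epath v0 w p \<and> reduced p" ..
  from someI_ex[OF this] show "epath v0 w (lift w)" "reduced (lift w)"
    unfolding lift_vertex_def by auto
qed

lemma reduce_in_\<Gamma>: "epath v0 v0 p \<Longrightarrow> reduce p \<in> \<Gamma>"
  by (simp add: fund_group_def is_path_reduce)

lemma close_path_in_\<Gamma>:
  assumes "w \<in> V" "epath v0 w p"
  shows "reduce (p @ word_inv (lift w)) \<in> \<Gamma>"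
proof (rule reduce_in_\<Gamma>)
  show "epath v0 v0 (p @ word_inv (lift w))"
    unfolding is_path_append using assms(2) is_path_word_inv[OF path_lift[OF assms(1)]]
    by (intro exI[of _ w] conjI)
qed

text \<open>The loop that follows \<open>p\<close> and returns along the chosen lift is the required
  \<open>g\<close>: \<open>\<Gamma>\<close> is transitive on the vertices of the tree over
  \<open>w\<close>.\<close>

lemma translate_lift:
  assumes "w \<in> V" "epath v0 w p" "reduced p"
  obtains g where "g \<in> \<Gamma>" "reduce (g @ lift w) = p"
proof
  show "reduce (p @ word_inv (lift w)) \<in> \<Gamma>"
    by (rule close_path_in_\<Gamma>[OF assms(1,2)])
  show "reduce (reduce (p @ word_inv (lift w)) @ lift w) = p"
    using reduce_word_inv_cancel(1)[of p "lift w" "[]"] assms(3) by (simp add: reduce_reduced)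
qed

text \<open>The usual generator attached to an edge, with independently chosen lifts in place of
  paths in a spanning tree.\<close>

definition edge_loop :: "'e \<times> bool \<Rightarrow> ('e \<times> bool) list" where
  "edge_loop oe = reduce (lift (tl_v oe) @ oe # word_inv (lift (hd_v oe)))"

text \<open>The lift of the base vertex is an arbitrary reduced loop, not necessarily the empty path, so
  it and its inverse have to be listed among the generators.\<close>

definition gens :: "('e \<times> bool) list set" where
  "gens = {reduce (lift v0), reduce (word_inv (lift v0))} \<union> edge_loop ` (E \<times> UNIV)"

lemma finite_gens: "finite gens"
  using finite_E by (simp add: gens_def)

lemma edge_loop_in_\<Gamma>: "fst oe \<in> E \<Longrightarrow> edge_loop oe \<in> \<Gamma>"
  unfolding edge_loop_def
  by (intro reduce_in_\<Gamma>)
    (auto simp: is_path_append intro!: exI[of _ "tl_v oe"] path_lift is_path_word_inv endpoints_in_V)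

lemma gens_subset: "gens \<subseteq> \<Gamma>"
  using edge_loop_in_\<Gamma> path_lift[OF v0] is_path_word_inv[OF path_lift[OF v0]]
  by (auto simp: gens_def intro: reduce_in_\<Gamma>)

lemma rho_closed: "g \<in> \<Gamma> \<Longrightarrow> \<rho> g \<in> carrier L"
  using rho_carrier by blast

lemma commute_reduce_append:
  assumes "z \<in> carrier L" "g \<in> \<Gamma>" "h \<in> \<Gamma>"
    and "z \<otimes> \<rho> g = \<rho> g \<otimes> z" "z \<otimes> \<rho> h = \<rho> h \<otimes> z"
  shows "z \<otimes> \<rho> (reduce (g @ h)) = \<rho> (reduce (g @ h)) \<otimes> z"
proof -
  have c: "\<rho> g \<in> carrier L" "\<rho> h \<in> carrier L" using assms rho_closed by auto
  have "z \<otimes> (\<rho> g \<otimes> \<rho> h) = \<rho> g \<otimes> (z \<otimes> \<rho> h)"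
    using assms c by (metis m_assoc)
  also have "\<dots> = \<rho> g \<otimes> \<rho> h \<otimes> z"
    using assms c by (simp add: m_assoc)
  finally show ?thesis using rho_hom assms by simp
qed

text \<open>Telescoping: closing \<open>q\<close> up along the chosen lift after each edge writes it
  as a product of edge loops, preceded by the inverse of the lift of \<open>v0\<close>.\<close>

lemma commute_path:
  assumes z: "z \<in> commutant (\<rho> ` gens)" and q: "epath v0 w q"
  shows "z \<otimes> \<rho> (reduce (q @ word_inv (lift w))) = \<rho> (reduce (q @ word_inv (lift w))) \<otimes> z"
  using q
proof (induction q arbitrary: w rule: rev_induct)
  case Nil
  then have "w = v0" by simp
  moreover have "reduce (word_inv (lift v0)) \<in> gens" by (simp add: gens_def)
  ultimately show ?case using z by (auto simp: commutant_def)
next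
  case (snoc oe q)
  then have q: "epath v0 (tl_v oe) q" and oe: "fst oe \<in> E" and w: "w = hd_v oe"
    by (auto simp: is_path_append)
  let ?m = "tl_v oe"
  let ?g = "reduce (q @ word_inv (lift ?m))"
  have g: "?g \<in> \<Gamma>"
    by (rule close_path_in_\<Gamma>[OF endpoints_in_V(1)[OF oe] q])
  have "edge_loop oe \<in> gens"
    using oe by (auto simp: gens_def mem_Times_iff)
  then have c: "z \<in> carrier L" "z \<otimes> \<rho> (edge_loop oe) = \<rho> (edge_loop oe) \<otimes> z"
    using z by (auto simp: commutant_def)
  have "z \<otimes> \<rho> (reduce (?g @ edge_loop oe)) = \<rho> (reduce (?g @ edge_loop oe)) \<otimes> z"
    by (rule commute_reduce_append[OF c(1) g edge_loop_in_\<Gamma>[OF oe] snoc.IH[OF q] c(2)])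
  moreover have "reduce (?g @ edge_loop oe) = reduce ((q @ [oe]) @ word_inv (lift w))"
    by (simp add: edge_loop_def w)
  ultimately show ?case by simp
qed

lemma commutant_gens: "commutant (\<rho> ` gens) \<subseteq> centraliser_image L \<Gamma> \<rho>"
proof
  fix z assume z: "z \<in> commutant (\<rho> ` gens)"
  have "z \<otimes> \<rho> g = \<rho> g \<otimes> z" if g: "g \<in> \<Gamma>" for g
  proof -
    have p: "epath v0 v0 g" "reduced g" using g by (auto simp: fund_group_def)
    \<comment> \<open>As \<open>lift v0\<close> may be nontrivial, \<open>?k\<close> is
      \<open>g\<close> times its inverse; multiplying by \<open>lift v0\<close> recovers
      \<open>g\<close>.\<close>
    let ?k = "reduce (g @ word_inv (lift v0))"
    have k: "?k \<in> \<Gamma>"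
      by (rule close_path_in_\<Gamma>[OF v0 p(1)])
    have l: "reduce (lift v0) \<in> \<Gamma>" using path_lift[OF v0] by (rule reduce_in_\<Gamma>)
    have c: "z \<in> carrier L" "z \<otimes> \<rho> (reduce (lift v0)) = \<rho> (reduce (lift v0)) \<otimes> z"
      using z by (auto simp: commutant_def gens_def)
    have "z \<otimes> \<rho> (reduce (?k @ reduce (lift v0))) = \<rho> (reduce (?k @ reduce (lift v0))) \<otimes> z"
      by (rule commute_reduce_append[OF c(1) k l commute_path[OF z p(1)] c(2)])
    moreover have "reduce (?k @ reduce (lift v0)) = g"
      using reduce_word_inv_cancel(1)[of g "lift v0" "[]"] p(2) by (simp add: reduce_reduced)
    ultimately show ?thesis by simp
  qed
  then show "z \<in> centraliser_image L \<Gamma> \<rho>"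
    using z by (auto simp: centraliser_image_def commutant_def)
qed

end

subsection \<open>Equivariant maps\<close>

locale rectifiable_equivariant_map = graph_representation L act V E src tgt len v0 \<rho>
  for L :: "('l, 'm) monoid_scheme" (structure) and act :: "'l \<Rightarrow> 'y::metric_space \<Rightarrow> 'y"
    and V :: "'v set" and E :: "'e set" and src tgt :: "'e \<Rightarrow> 'v" and len :: "'e \<Rightarrow> real"
    and v0 :: 'v and \<rho> :: "('e \<times> bool) list \<Rightarrow> 'l" +
  fixes u :: "('e \<times> bool) list \<times> ('e \<times> bool) \<times> real \<Rightarrow> 'y"
  assumes equivariant: "equivariant_map E src tgt len v0 act \<rho> u"
    and rectifiable: "locally_rectifiable E src tgt len v0 u"
begin

abbreviation "Lu \<equiv> map_length E src tgt len v0 u"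

lemma vertex_well_defined: "pt (p, oe, 0) \<Longrightarrow> pt (p, oe', 0) \<Longrightarrow> u (p, oe, 0) = u (p, oe', 0)"
  and edge_flip: "pt (p, oe, t) \<Longrightarrow> u (p, oe, t) = u (reduce (p @ [oe]), oflip oe, len (fst oe) - t)"
  and equivariance: "g \<in> \<Gamma> \<Longrightarrow> pt (p, oe, t) \<Longrightarrow> u (reduce (g @ p), oe, t) = act (\<rho> g) (u (p, oe, t))"
  using equivariant unfolding equivariant_map_def tree_map_def by blast+

lemma pt_lift:
  "e \<in> E \<Longrightarrow> 0 \<le> t \<Longrightarrow> t \<le> len e \<Longrightarrow> pt (lift (src e), (e, True), t)"
  using path_lift reduced_lift endpoints_in_V(1)[of "(e, True)"] by (simp add: tree_point_def)

lemma rectifiable_lift: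
  assumes "e \<in> E"
  shows "rectifiable_curve (\<lambda>t. u (lift (src e), (e, True), t)) 0 (len e)"
proof -
  have "pt (lift (src e), (e, True), 0)"
    using assms graph by (auto intro!: pt_lift simp: metric_graph_def less_imp_le)
  then show ?thesis using rectifiable unfolding locally_rectifiable_def by fastforce
qed

text \<open>A chord is at most the length of its edge, which is one of the nonnegative summands of
  \<open>Lu\<close>.\<close>

lemma dist_lift_le:
  assumes "e \<in> E" "0 \<le> s" "s \<le> len e" "0 \<le> t" "t \<le> len e"
  shows "dist (u (lift (src e), (e, True), s)) (u (lift (src e), (e, True), t)) \<le> Lu"
proof -
  define c where "c e = (\<lambda>t. u (lift (src e), (e, True), t))" for e
  have rc: "rectifiable_curve (c e) 0 (len e)" if "e \<in> E" for e
    unfolding c_def by (rule rectifiable_lift[OF that])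
  have le: "dist (c e s) (c e t) \<le> curve_length (c e) 0 (len e)"
    if "e \<in> E" "0 \<le> s" "s \<le> t" "t \<le> len e" for e s t
    using dist_le_curve_length[OF rc[OF that(1)] that(2-4)]
      zero_le_dist[of "c e 0" "c e s"] zero_le_dist[of "c e t" "c e (len e)"] by linarith
  have "0 \<le> curve_length (c e) 0 (len e)" if "e \<in> E" for e
    using le[OF that, of 0 0] that graph by (auto simp: metric_graph_def less_imp_le)
  then have "curve_length (c e) 0 (len e) \<le> Lu"
    unfolding map_length_def c_def using finite_E assms(1) by (intro member_le_sum) auto
  moreover have "dist (c e s) (c e t) \<le> curve_length (c e) 0 (len e)"
    using le[of e s t] le[of e t s] assms by (cases "s \<le> t") (auto simp: dist_commute)
  ultimately show ?thesis by (simp add: c_def)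
qed

text \<open>Equivariance moves the edge to the chosen lift by an isometry; an edge read in reverse
  is first rewritten from its other end.\<close>

lemma dist_edge_le:
  assumes "pt (p, oe, s)" "pt (p, oe, t)"
  shows "dist (u (p, oe, s)) (u (p, oe, t)) \<le> Lu"
proof -
  have *: "dist (u (p, (e, True), s)) (u (p, (e, True), t)) \<le> Lu"
    if "pt (p, (e, True), s)" "pt (p, (e, True), t)" for p e s t
  proof -
    have e: "e \<in> E" "src e \<in> V" "epath v0 (src e) p" "reduced p" "0 \<le> s" "s \<le> len e" "0 \<le> t" "t \<le> len e"
      using that endpoints_in_V(1)[of "(e, True)"] by (auto simp: tree_point_def)
    obtain g where g: "g \<in> \<Gamma>" "reduce (g @ lift (src e)) = p"
      using translate_lift e by blast
    have "u (p, (e, True), r) = act (\<rho> g) (u (lift (src e), (e, True), r))"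
      if "0 \<le> r" "r \<le> len e" for r
      using equivariance[OF g(1) pt_lift[OF e(1) that]] g(2) by simp
    then show ?thesis using e g dist_lift_le by (simp add: rho_closed)
  qed
  obtain e b where oe: "oe = (e, b)" by (cases oe)
  show ?thesis
  proof (cases b)
    case True
    then show ?thesis using * assms oe by simp
  next
    case False
    have "pt (reduce (p @ [oe]), (e, True), len e - r)" if "pt (p, oe, r)" for r
      using that oe False
      by (auto simp: tree_point_def is_path_append intro!: is_path_reduce)
    moreover have "u (p, oe, r) = u (reduce (p @ [oe]), (e, True), len e - r)" if "pt (p, oe, r)" for r
      using edge_flip[OF that] oe False by simp
    ultimately show ?thesis using * assms by simp
  qed
qed

text \<open>Each letter of \<open>q\<close> costs at most \<open>Lu\<close>, backtracking included.
  The edges \<open>oe0\<close> and \<open>oe\<close> only serve to name the two vertices.\<close>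

lemma dist_path_le:
  assumes o: "pt ([], oe0, 0)" and q: "epath v0 (tl_v oe) q" "fst oe \<in> E"
  shows "dist (u ([], oe0, 0)) (u (reduce q, oe, 0)) \<le> real (length q) * Lu"
  using q
proof (induction q arbitrary: oe rule: rev_induct)
  case Nil
  have "pt ([], oe, 0)"
    using Nil o graph by (auto simp: tree_point_def metric_graph_def less_imp_le)
  then have "u ([], oe0, 0) = u ([], oe, 0)" using vertex_well_defined o by blast
  then show ?case by simp
next
  case (snoc a q)
  then have a: "epath v0 (tl_v a) q" "fst a \<in> E" "hd_v a = tl_v oe" by (auto simp: is_path_append)
  have len: "0 \<le> len (fst b)" if "fst b \<in> E" for b :: "'e \<times> bool"
    using that graph by (auto simp: metric_graph_def less_imp_le)
  have pa: "pt (reduce q, a, 0)" "pt (reduce q, a, len (fst a))"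
    using a is_path_reduce[OF a(1)] len[of a] by (auto simp: tree_point_def)
  have pr: "epath v0 (tl_v oe) (reduce (q @ [a]))"
    using snoc.prems(1) by (rule is_path_reduce)
  \<comment> \<open>The far end of \<open>a\<close> is the start of its reverse, and as a vertex it
    may be named by \<open>oe\<close> instead.\<close>
  have "u (reduce q, a, len (fst a)) = u (reduce (q @ [a]), oflip a, 0)"
    using edge_flip[OF pa(2)] by simp
  also have "\<dots> = u (reduce (q @ [a]), oe, 0)"
    using pr a snoc.prems(2) len[of a] len[of oe]
    by (intro vertex_well_defined) (auto simp: tree_point_def)
  finally have "dist (u (reduce q, a, 0)) (u (reduce (q @ [a]), oe, 0)) \<le> Lu"
    using dist_edge_le[OF pa] by simp
  then show ?case
    using snoc.IH[OF a(1,2)]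
      dist_triangle[of "u ([], oe0, 0)" "u (reduce (q @ [a]), oe, 0)" "u (reduce q, a, 0)"]
    by (simp add: algebra_simps)
qed

text \<open>The translate of the vertex \<open>[]\<close> by \<open>g\<close> is the vertex
  \<open>g\<close>, reached along the word \<open>g\<close> itself.\<close>

lemma displacement_le:
  assumes "pt ([], oe0, 0)" "g \<in> \<Gamma>"
  shows "dist (u ([], oe0, 0)) (act (\<rho> g) (u ([], oe0, 0))) \<le> real (length g) * Lu"
proof -
  have "epath v0 (tl_v oe0) g" "fst oe0 \<in> E" "reduced g"
    using assms by (auto simp: tree_point_def fund_group_def)
  then show ?thesis
    using dist_path_le[OF assms(1), of oe0 g] equivariance[OF assms(2,1)] by (simp add: reduce_reduced)
qed

text \<open>The edges issuing from the chosen lifts contain a point of every orbit of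
  \<open>\<Gamma>\<close>; walk to the lift, then along one edge.\<close>

lemma dist_domain_le:
  assumes "pt ([], oe0, 0)" "pt (lift (tl_v oe), oe, t)" "fst oe \<in> E"
  shows "dist (u ([], oe0, 0)) (u (lift (tl_v oe), oe, t)) \<le> (real (length (lift (tl_v oe))) + 1) * Lu"
proof -
  let ?p = "lift (tl_v oe)"
  have p: "epath v0 (tl_v oe) ?p" "reduced ?p"
    using assms(2) by (auto simp: tree_point_def)
  have "pt (?p, oe, 0)" using assms(2) by (auto simp: tree_point_def)
  then have "dist (u (?p, oe, 0)) (u (?p, oe, t)) \<le> Lu"
    using dist_edge_le assms(2) by blast
  moreover have "dist (u ([], oe0, 0)) (u (?p, oe, 0)) \<le> real (length ?p) * Lu"
    using dist_path_le[OF assms(1) p(1) assms(3)] p(2) by (simp add: reduce_reduced)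
  ultimately show ?thesis
    using dist_triangle[of "u ([], oe0, 0)" "u (?p, oe, t)" "u (?p, oe, 0)"]
    by (simp add: algebra_simps)
qed

lemma map_length_nonneg: "0 \<le> Lu"
proof -
  have "0 \<le> curve_length (\<lambda>t. u (lift (src e), (e, True), t)) 0 (len e)" if "e \<in> E" for e
  proof -
    have "0 \<le> len e" using that graph by (auto simp: metric_graph_def less_imp_le)
    then have "dist (u (lift (src e), (e, True), 0)) (u (lift (src e), (e, True), len e))
        \<le> curve_length (\<lambda>t. u (lift (src e), (e, True), t)) 0 (len e)"
      using dist_le_curve_length[OF rectifiable_lift[OF that], of 0 0] by simp
    then show ?thesis by (rule order_trans[OF zero_le_dist])
  qed
  then show ?thesis unfolding map_length_def by (intro sum_nonneg) auto
qed

end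

section \<open>Comparison of two equivariant maps\<close>

context graph_representation
begin

text \<open>Naming the vertex \<open>[]\<close> takes an edge leaving \<open>v0\<close>: the first
  letter of \<open>p\<close>, or the edge of the point itself if \<open>p\<close> is empty.\<close>

lemma base_point_exists:
  assumes "pt x"
  obtains oe0 where "pt ([], oe0, 0)"
proof -
  obtain p oe t where x: "x = (p, oe, t)" by (cases x)
  have len: "0 \<le> len (fst b)" if "fst b \<in> E" for b :: "'e \<times> bool"
    using that graph by (auto simp: metric_graph_def less_imp_le)
  show ?thesis
  proof (cases p)
    case Nil
    then show ?thesis using that[of oe] assms x len by (auto simp: tree_point_def)
  next
    case (Cons a r)
    then show ?thesis using that[of a] assms x len by (auto simp: tree_point_def)
  qed
qed

lemma one_centralises: "\<one> \<in> centraliser_image L \<Gamma> \<rho>"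
  using rho_closed by (auto simp: centraliser_image_def)

lemma bounded_width_up_to_centraliser:
  "\<exists>Cstar C::real. \<forall>u v.
           equivariant_map E src tgt len v0 act \<rho> u \<and> locally_rectifiable E src tgt len v0 u \<and>
           equivariant_map E src tgt len v0 act \<rho> v \<and> locally_rectifiable E src tgt len v0 v \<longrightarrow>
           (\<exists>h\<in>centraliser_image L \<Gamma> \<rho>. \<forall>x. pt x \<longrightarrow>
                 dist (u x) (act h (v x))
                   \<le> Cstar * (map_length E src tgt len v0 u + map_length E src tgt len v0 v) + C)"
proof (cases "\<exists>x. pt x")
  \<comment> \<open>A graph without edges has no represented points, so the bound is vacuous and
    \<open>\<one>\<close> serves as \<open>h\<close>.\<close>
  case False
  then show ?thesis using one_centralises by blast
next
  case True
  then obtain oe0 where o: "pt ([], oe0, 0)" using base_point_exists by blast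
  define N where "N = real (\<Sum>g\<in>gens. length g)"
  define M where "M = real (\<Sum>w\<in>V. length (lift w))"
  have N: "real (length g) \<le> N" if "g \<in> gens" for g
    unfolding N_def of_nat_le_iff using finite_gens that by (intro member_le_sum) auto
  have M: "real (length (lift w)) \<le> M" if "w \<in> V" for w
    unfolding M_def of_nat_le_iff using finite_V that by (intro member_le_sum) auto
  have S: "finite (\<rho> ` gens)" "\<rho> ` gens \<subseteq> carrier L"
    using finite_gens gens_subset rho_closed by auto
  \<comment> \<open>An arbitrary reference point, fixed before \<open>u\<close> and \<open>v\<close>
    so that \<open>A\<close> is independent of them.\<close>
  obtain y :: 'y where True by blast
  obtain A where A: "A \<ge> 0"
    "\<And>p D. D \<ge> 0 \<Longrightarrow> (\<And>s. s \<in> \<rho> ` gens \<Longrightarrow> dist p (act s p) \<le> D) \<Longrightarrow>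
      \<exists>h\<in>commutant (\<rho> ` gens). dist p (act h y) \<le> A * D + A"
    using dist_commutant_orbit_le_displacement[OF S, of y] by blast
  have near: "\<exists>h\<in>commutant (\<rho> ` gens).
      dist (u ([], oe0, 0)) (act h y) \<le> A * (N * map_length E src tgt len v0 u) + A"
    if "equivariant_map E src tgt len v0 act \<rho> u" "locally_rectifiable E src tgt len v0 u" for u
  proof -
    interpret rectifiable_equivariant_map L act V E src tgt len v0 \<rho> u
      by unfold_locales (use that in auto)
    have "dist (u ([], oe0, 0)) (act s (u ([], oe0, 0))) \<le> N * Lu" if s: "s \<in> \<rho> ` gens" for s
    proof -
      obtain g where g: "g \<in> gens" "s = \<rho> g" using s by blast
      have "dist (u ([], oe0, 0)) (act s (u ([], oe0, 0))) \<le> real (length g) * Lu"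
        using displacement_le[OF o] g gens_subset by blast
      also have "\<dots> \<le> N * Lu" using N[OF g(1)] map_length_nonneg by (rule mult_right_mono)
      finally show ?thesis .
    qed
    moreover have "0 \<le> N * Lu" using map_length_nonneg by (simp add: N_def del: of_nat_sum)
    ultimately show ?thesis using A(2) by blast
  qed
  \<comment> \<open>\<open>A * N\<close> and \<open>2 * A\<close> come from the two estimates at the
    base vertex, \<open>M + 1\<close> from walking to the lift of a vertex and along one
    edge.\<close>
  have "\<exists>h\<in>centraliser_image L \<Gamma> \<rho>. \<forall>x. pt x \<longrightarrow> dist (u x) (act h (v x))
      \<le> (A * N + M + 1) * (map_length E src tgt len v0 u + map_length E src tgt len v0 v) + 2 * A"
    if u: "equivariant_map E src tgt len v0 act \<rho> u" "locally_rectifiable E src tgt len v0 u"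
      and v: "equivariant_map E src tgt len v0 act \<rho> v" "locally_rectifiable E src tgt len v0 v" for u v
  proof -
    interpret u: rectifiable_equivariant_map L act V E src tgt len v0 \<rho> u
      by unfold_locales (use u in auto)
    interpret v: rectifiable_equivariant_map L act V E src tgt len v0 \<rho> v
      by unfold_locales (use v in auto)
    let ?u = "u ([], oe0, 0)" and ?v = "v ([], oe0, 0)"
    obtain a where a: "a \<in> commutant (\<rho> ` gens)" "dist ?u (act a y) \<le> A * (N * u.Lu) + A"
      using near[OF u] by blast
    obtain b where b: "b \<in> commutant (\<rho> ` gens)" "dist ?v (act b y) \<le> A * (N * v.Lu) + A"
      using near[OF v] by blast
    \<comment> \<open>Chosen to carry \<open>act b y\<close>, which is near \<open>v\<close> at the
      base vertex, to \<open>act a y\<close>, which is near \<open>u\<close> there.\<close>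
    define h where "h = a \<otimes> inv b"
    have h: "h \<in> centraliser_image L \<Gamma> \<rho>"
      using commutant_mult_inv[OF S(2) a(1) b(1)] commutant_gens by (auto simp: h_def)
    then have hc: "h \<in> carrier L" by (simp add: centraliser_image_def)
    have c: "a \<in> carrier L" "b \<in> carrier L" using a b by (auto simp: commutant_def)
    have "dist (act a y) (act h ?v) = dist (act b y) ?v"
      using c by (simp add: h_def act_mult act_dist_inv)
    then have base: "dist ?u (act h ?v) \<le> A * N * (u.Lu + v.Lu) + 2 * A"
      using a(2) b(2) dist_triangle[of ?u "act h ?v" "act a y"]
      by (simp add: dist_commute algebra_simps)
    have "dist (u x) (act h (v x)) \<le> (A * N + M + 1) * (u.Lu + v.Lu) + 2 * A" if x: "pt x" for x
    proof -
      obtain p oe t where xp: "x = (p, oe, t)" by (cases x)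
      have e: "fst oe \<in> E" "epath v0 (tl_v oe) p" "reduced p" "0 \<le> t" "t \<le> len (fst oe)"
        using x xp by (auto simp: tree_point_def)
      have w: "tl_v oe \<in> V" using endpoints_in_V e by blast
      let ?p = "lift (tl_v oe)"
      have pt: "pt (?p, oe, t)" using e w path_lift reduced_lift by (auto simp: tree_point_def)
      \<comment> \<open>Since \<open>h\<close> commutes with \<open>\<rho> g\<close>, the distance
        to be bounded is invariant under \<open>\<Gamma>\<close>, and \<open>x\<close> may be moved
        to a chosen lift.\<close>
      obtain g where g: "g \<in> \<Gamma>" "reduce (g @ ?p) = p" using translate_lift w e by blast
      have gc: "\<rho> g \<in> carrier L" "h \<otimes> \<rho> g = \<rho> g \<otimes> h"
        using g(1) h rho_closed by (auto simp: centraliser_image_def)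
      have "u x = act (\<rho> g) (u (?p, oe, t))" "v x = act (\<rho> g) (v (?p, oe, t))"
        using u.equivariance[OF g(1) pt] v.equivariance[OF g(1) pt] g(2) xp by auto
      moreover have "act h (act (\<rho> g) z) = act (\<rho> g) (act h z)" for z
        using gc hc act_mult[of h "\<rho> g" z] act_mult[of "\<rho> g" h z] by simp
      ultimately have "dist (u x) (act h (v x)) = dist (u (?p, oe, t)) (act h (v (?p, oe, t)))"
        using gc by simp
      also have "\<dots> \<le> dist ?u (u (?p, oe, t)) + dist ?u (act h ?v) + dist ?v (v (?p, oe, t))"
        using dist_triangle[of "u (?p, oe, t)" "act h (v (?p, oe, t))" ?u]
          dist_triangle[of ?u "act h (v (?p, oe, t))" "act h ?v"]
          act_dist[OF hc, of ?v "v (?p, oe, t)"] dist_commute[of "u (?p, oe, t)" ?u] by linarith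
      also have "\<dots> \<le> (M + 1) * u.Lu + (A * N * (u.Lu + v.Lu) + 2 * A) + (M + 1) * v.Lu"
      proof (intro add_mono base)
        have len: "real (length ?p) + 1 \<le> M + 1" using M[OF w] by simp
        show "dist ?u (u (?p, oe, t)) \<le> (M + 1) * u.Lu"
          using u.dist_domain_le[OF o pt e(1)] mult_right_mono[OF len u.map_length_nonneg] by linarith
        show "dist ?v (v (?p, oe, t)) \<le> (M + 1) * v.Lu"
          using v.dist_domain_le[OF o pt e(1)] mult_right_mono[OF len v.map_length_nonneg] by linarith
      qed
      finally show ?thesis by (simp add: algebra_simps)
    qed
    then show ?thesis using h by blast
  qed
  then show ?thesis by blast
qed

end

theorem theorem4:
  fixes V :: "'v set" and E :: "'e set" and src tgt :: "'e \<Rightarrow> 'v" and len :: "'e \<Rightarrow> real"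
    and v0 :: 'v
    and L :: "('l, 'm) monoid_scheme" and act :: "'l \<Rightarrow> 'y::metric_space \<Rightarrow> 'y"
    and \<rho> :: "('e \<times> bool) list \<Rightarrow> 'l"
  assumes G: "metric_graph V E src tgt len"
    and conn: "connected_graph V E src tgt"
    and noterm: "no_terminal_vertices V E src tgt"
    and v0: "v0 \<in> V"
    and Y: "hadamard_space TYPE('y)" and Ylc: "locally_compact_space TYPE('y)"
    and grp: "group L"
    and isom: "isometric_action L act"
    and proper: "proper_action L act"
    and cocpt: "cocompact_action L act"
    and rho_carrier: "\<rho> ` fund_group E src tgt v0 \<subseteq> carrier L"
    and rho_hom: "\<forall>g\<in>fund_group E src tgt v0. \<forall>h\<in>fund_group E src tgt v0.
                    \<rho> (reduce (g @ h)) = \<rho> g \<otimes>\<^bsub>L\<^esub> \<rho> h"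
  shows "\<exists>Cstar C::real. \<forall>u v.
           equivariant_map E src tgt len v0 act \<rho> u \<and> locally_rectifiable E src tgt len v0 u \<and>
           equivariant_map E src tgt len v0 act \<rho> v \<and> locally_rectifiable E src tgt len v0 v \<longrightarrow>
           (\<exists>h\<in>centraliser_image L (fund_group E src tgt v0) \<rho>.
              \<forall>x. tree_point E src tgt len v0 x \<longrightarrow>
                 dist (u x) (act h (v x))
                   \<le> Cstar * (map_length E src tgt len v0 u + map_length E src tgt len v0 v) + C)"
proof -
  interpret group L by (rule grp)
  interpret graph_representation L act V E src tgt len v0 \<rho>
    by unfold_locales (use assms in auto)
  show ?thesis by (rule bounded_width_up_to_centraliser)
qed

end
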